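(* Let $n\ge 1$. The multiplicative semigroup $(A^+(B_n),\circ)$ is regular, i.e. for every $f\in A^+(B_n)$ there is $g\in A^+(B_n)$ with $f\circ g\circ f=f$.
   Context: For $n\ge 1$ let $[n]=\{1,\dots,n\}$. The Brandt semigroup $(B_n,+)$ has underlying set $B_n=([n]\times[n])\cup\{\vartheta\}$ with $(i,j)+(k,l)=(i,l)$ if $j=k$, $(i,j)+(k,l)=\vartheta$ if $j\ne k$, and $\alpha+\vartheta=\vartheta+\alpha=\vartheta$ for all $\alpha\in B_n$. $M(B_n)$ is the set of all maps $B_n\to B_n$; arguments are written on the left of functions. It carries pointwise addition $\alpha(f+g)=\alpha f+\alpha g$ and composition $\alpha(f\circ g)=(\alpha f)g$. An affine map over $B_n$ is a map of the form $g+h$ with $g$ an endomorphism of the semigroup $(B_n,+)$ (not required to fix $\vartheta$) and $h\in M(B_n)$ a constant map. $A^+(B_n)$ (the affine near-semiring over $B_n$) is the smallest subset of $M(B_n)$ that contains all affine maps and is closed under $+$ and $\circ$. *)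

theory Defs
  imports "HOL-Library.FuncSet"
begin

datatype brandt = Pt nat nat | Zero  (\<open>\<theta>\<close>)

fun brandt_add :: "brandt \<Rightarrow> brandt \<Rightarrow> brandt"  (infixl \<open>\<oplus>\<^sub>B\<close> 65) where
  "Pt i j \<oplus>\<^sub>B Pt k l = (if j = k then Pt i l else \<theta>)"
| "\<theta> \<oplus>\<^sub>B b = \<theta>"
| "Pt i j \<oplus>\<^sub>B \<theta> = \<theta>"

definition brandt_carrier :: "nat \<Rightarrow> brandt set" where
  "brandt_carrier n = {Pt i j | i j. i \<in> {1..n} \<and> j \<in> {1..n}} \<union> {\<theta>}"

text \<open>Maps on the Brandt semigroup are represented by extensional functions
  (undefined outside the carrier), so that equality of maps is HOL equality.\<close>

definition brandt_maps :: "nat \<Rightarrow> (brandt \<Rightarrow> brandt) set" where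
  "brandt_maps n = brandt_carrier n \<rightarrow>\<^sub>E brandt_carrier n"

definition bn_add :: "nat \<Rightarrow> (brandt \<Rightarrow> brandt) \<Rightarrow> (brandt \<Rightarrow> brandt) \<Rightarrow> (brandt \<Rightarrow> brandt)" where
  "bn_add n f g = (\<lambda>a \<in> brandt_carrier n. f a \<oplus>\<^sub>B g a)"

text \<open>Arguments are written on the left of maps, so the left factor of a
  composition is applied first.\<close>

definition bn_comp :: "nat \<Rightarrow> (brandt \<Rightarrow> brandt) \<Rightarrow> (brandt \<Rightarrow> brandt) \<Rightarrow> (brandt \<Rightarrow> brandt)" where
  "bn_comp n f g = (\<lambda>a \<in> brandt_carrier n. g (f a))"

definition brandt_endo :: "nat \<Rightarrow> (brandt \<Rightarrow> brandt) set" where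
  "brandt_endo n = {g \<in> brandt_maps n.
     \<forall>a \<in> brandt_carrier n. \<forall>b \<in> brandt_carrier n. g (a \<oplus>\<^sub>B b) = g a \<oplus>\<^sub>B g b}"

definition brandt_const :: "nat \<Rightarrow> (brandt \<Rightarrow> brandt) set" where
  "brandt_const n = {(\<lambda>a \<in> brandt_carrier n. c) | c. c \<in> brandt_carrier n}"

definition affine_maps :: "nat \<Rightarrow> (brandt \<Rightarrow> brandt) set" where
  "affine_maps n = {bn_add n g h | g h. g \<in> brandt_endo n \<and> h \<in> brandt_const n}"

inductive_set affine_nsr :: "nat \<Rightarrow> (brandt \<Rightarrow> brandt) set" for n :: nat where
  affine: "f \<in> affine_maps n \<Longrightarrow> f \<in> affine_nsr n"
| add: "f \<in> affine_nsr n \<Longrightarrow> g \<in> affine_nsr n \<Longrightarrow> bn_add n f g \<in> affine_nsr n"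
| comp: "f \<in> affine_nsr n \<Longrightarrow> g \<in> affine_nsr n \<Longrightarrow> bn_comp n f g \<in> affine_nsr n"

lemma Pt_in_brandt_carrier [simp]:
  "Pt i j \<in> brandt_carrier n \<longleftrightarrow> i \<in> {1..n} \<and> j \<in> {1..n}"
  unfolding brandt_carrier_def by blast

lemma Zero_in_brandt_carrier [simp]: "\<theta> \<in> brandt_carrier n"
  unfolding brandt_carrier_def by blast

lemma brandt_add_Zero [simp]: "a \<oplus>\<^sub>B \<theta> = \<theta>"
  by (cases a) simp_all

lemma brandt_add_closed:
  assumes "a \<in> brandt_carrier n" "b \<in> brandt_carrier n"
  shows "a \<oplus>\<^sub>B b \<in> brandt_carrier n"
  using assms by (cases a; cases b) simp_all

lemma brandt_add_assoc: "(a \<oplus>\<^sub>B b) \<oplus>\<^sub>B c = a \<oplus>\<^sub>B (b \<oplus>\<^sub>B c)"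
  by (cases a; cases b; cases c) simp_all

lemma bn_add_maps:
  "f \<in> brandt_maps n \<Longrightarrow> g \<in> brandt_maps n \<Longrightarrow> bn_add n f g \<in> brandt_maps n"
  unfolding bn_add_def brandt_maps_def by (intro restrict_PiE_iff[THEN iffD2] ballI brandt_add_closed) auto

lemma bn_comp_maps:
  "f \<in> brandt_maps n \<Longrightarrow> g \<in> brandt_maps n \<Longrightarrow> bn_comp n f g \<in> brandt_maps n"
  unfolding bn_comp_def brandt_maps_def by (intro restrict_PiE_iff[THEN iffD2] ballI) auto

lemma affine_nsr_maps: "f \<in> affine_nsr n \<Longrightarrow> f \<in> brandt_maps n"
proof (induction rule: affine_nsr.induct)
  case (affine f)
  then obtain g h where f: "f = bn_add n g h"
    and g: "g \<in> brandt_endo n" and h: "h \<in> brandt_const n"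
    unfolding affine_maps_def by blast
  from g have "g \<in> brandt_maps n" by (simp add: brandt_endo_def)
  moreover from h have "h \<in> brandt_maps n"
    by (auto simp: brandt_const_def brandt_maps_def)
  ultimately show ?case unfolding f by (rule bn_add_maps)
qed (simp_all add: bn_add_maps bn_comp_maps)

lemma bn_comp_assoc:
  assumes "f \<in> affine_nsr n"
  shows "bn_comp n (bn_comp n f g) h = bn_comp n f (bn_comp n g h)"
proof
  fix a
  have "f a \<in> brandt_carrier n" if "a \<in> brandt_carrier n"
    using affine_nsr_maps[OF assms] that by (auto simp: brandt_maps_def)
  then show "bn_comp n (bn_comp n f g) h a = bn_comp n f (bn_comp n g h) a"
    by (simp add: bn_comp_def)
qed

end

theory Submission
  imports Defs
begin

text \<open>
  An endomorphism of \<open>B\<^sub>n\<close> is either constant with idempotent value or the automorphism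
  \<open>(i, j) \<mapsto> (i\<sigma>, j\<sigma>)\<close> of a permutation \<open>\<sigma>\<close>. Adding a constant to the latter leaves only one
  column \<open>{(i, k) | i}\<close> in the support, and all further sums and compositions are constant,
  supported on one column, or supported on one point. A constant is its own generalized inverse;
  a column map is inverted by swapping source and target column and inverting \<open>\<sigma>\<close>; a point map
  is inverted by swapping source and target.
\<close>

section \<open>Normal forms: constant, column and point maps\<close>

definition const_map :: "nat \<Rightarrow> brandt \<Rightarrow> brandt \<Rightarrow> brandt" where
  "const_map n c = (\<lambda>a \<in> brandt_carrier n. c)"

definition column_map :: "nat \<Rightarrow> nat \<Rightarrow> nat \<Rightarrow> (nat \<Rightarrow> nat) \<Rightarrow> brandt \<Rightarrow> brandt" where
  "column_map n k p \<sigma> =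
     (\<lambda>a \<in> brandt_carrier n. case a of Pt i j \<Rightarrow> if j = k then Pt (\<sigma> i) p else \<theta> | \<theta> \<Rightarrow> \<theta>)"

definition point_map :: "nat \<Rightarrow> brandt \<Rightarrow> brandt \<Rightarrow> brandt \<Rightarrow> brandt" where
  "point_map n a b = (\<lambda>x \<in> brandt_carrier n. if x = a then b else \<theta>)"

definition perm_map :: "nat \<Rightarrow> (nat \<Rightarrow> nat) \<Rightarrow> brandt \<Rightarrow> brandt" where
  "perm_map n \<sigma> = (\<lambda>a \<in> brandt_carrier n. case a of Pt i j \<Rightarrow> Pt (\<sigma> i) (\<sigma> j) | \<theta> \<Rightarrow> \<theta>)"

text \<open>The value of a point map may be \<open>\<theta>\<close>; it is then the zero map.\<close>

inductive_set normal_maps :: "nat \<Rightarrow> (brandt \<Rightarrow> brandt) set" for n :: nat where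
  const: "c \<in> brandt_carrier n \<Longrightarrow> const_map n c \<in> normal_maps n"
| column: "k \<in> {1..n} \<Longrightarrow> p \<in> {1..n} \<Longrightarrow> bij_betw \<sigma> {1..n} {1..n} \<Longrightarrow>
    column_map n k p \<sigma> \<in> normal_maps n"
| point: "i \<in> {1..n} \<Longrightarrow> j \<in> {1..n} \<Longrightarrow> b \<in> brandt_carrier n \<Longrightarrow>
    point_map n (Pt i j) b \<in> normal_maps n"

lemmas map_defs = const_map_def column_map_def point_map_def perm_map_def bn_add_def bn_comp_def

lemma point_map_Zero: "point_map n a \<theta> = const_map n \<theta>"
  by (auto simp: map_defs)

lemma bij_betw_ex_preimage: "bij_betw \<sigma> A B \<Longrightarrow> y \<in> B \<Longrightarrow> \<exists>x\<in>A. \<sigma> x = y"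
  by (auto simp: bij_betw_def)

lemma normal_maps_subset: "normal_maps n \<subseteq> brandt_maps n"
proof
  fix f assume "f \<in> normal_maps n"
  then show "f \<in> brandt_maps n"
  proof cases
    case (column k p \<sigma>)
    then show ?thesis using bij_betwE[OF column(4)]
      by (auto simp: map_defs brandt_maps_def split: brandt.split)
  qed (auto simp: map_defs brandt_maps_def)
qed

lemma normal_maps_closed: "f \<in> normal_maps n \<Longrightarrow> a \<in> brandt_carrier n \<Longrightarrow> f a \<in> brandt_carrier n"
  using normal_maps_subset by (fastforce simp: brandt_maps_def)

section \<open>Closure of the normal forms under addition\<close>

text \<open>As \<open>\<theta>\<close> is absorbing, a sum with a point map vanishes off
  \<open>a\<close>, whatever \<open>f\<close> is.\<close>

lemma bn_add_point_right: "bn_add n f (point_map n a b) = point_map n a (f a \<oplus>\<^sub>B b)"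
  by (auto simp: map_defs)

lemma bn_add_point_left: "bn_add n (point_map n a b) f = point_map n a (b \<oplus>\<^sub>B f a)"
  by (auto simp: map_defs)

text \<open>In column \<open>k\<close> the inner indices are \<open>\<sigma> i\<close> and
  \<open>\<sigma> x\<close>; by injectivity they agree only in row \<open>x = i\<close>. Writing the
  index as \<open>\<sigma> i\<close> names the surviving row without an inverse of
  \<open>\<sigma>\<close>.\<close>

lemma const_add_column:
  assumes "bij_betw \<sigma> {1..n} {1..n}" "i \<in> {1..n}"
  shows "bn_add n (const_map n (Pt r (\<sigma> i))) (column_map n k p \<sigma>) = point_map n (Pt i k) (Pt r p)"
  using assms(2) inj_on_eq_iff[OF bij_betw_imp_inj_on[OF assms(1)]]
  by (auto simp: map_defs fun_eq_iff split: brandt.split)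

lemma column_add_const:
  "bn_add n (column_map n k p \<sigma>) (const_map n (Pt u v)) =
     (if u = p then column_map n k v \<sigma> else const_map n \<theta>)"
  by (auto simp: map_defs fun_eq_iff split: brandt.split)

text \<open>Distinct source columns give disjoint supports. On a common column, row \<open>x\<close>
  survives only if \<open>\<tau> i = \<tau> x\<close>, hence only for \<open>x = i\<close>.\<close>

lemma column_add_column:
  assumes "bij_betw \<tau> {1..n} {1..n}" "i \<in> {1..n}"
  shows "bn_add n (column_map n k (\<tau> i) \<sigma>) (column_map n l q \<tau>) =
    (if k = l then point_map n (Pt i k) (Pt (\<sigma> i) q) else const_map n \<theta>)"
  using assms(2) inj_on_eq_iff[OF bij_betw_imp_inj_on[OF assms(1)]]
  by (auto simp: map_defs fun_eq_iff split: brandt.split)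

text \<open>A point summand on either side gives a point map by absorption, so real computation
  remains only for constants and columns.\<close>

lemma normal_maps_add:
  assumes f: "f \<in> normal_maps n" and g: "g \<in> normal_maps n"
  shows "bn_add n f g \<in> normal_maps n"
  using g
proof cases
  case (point i j b)
  then show ?thesis
    by (auto simp: bn_add_point_right intro!: normal_maps.point brandt_add_closed normal_maps_closed[OF f])
next
  case gc: (const c)
  from f show ?thesis
  proof cases
    case (const d)
    have "bn_add n f g = const_map n (d \<oplus>\<^sub>B c)" by (auto simp: gc const map_defs)
    then show ?thesis using gc const by (simp add: normal_maps.const brandt_add_closed)
  next
    case (column k p \<sigma>)
    show ?thesis
    proof (cases c)
      case (Pt u v)
      then show ?thesis using gc column by (auto simp: column_add_const intro: normal_maps.intros)
    next
      case Zero
      have "bn_add n f g = const_map n \<theta>" by (auto simp: gc Zero map_defs)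
      then show ?thesis by (simp add: normal_maps.const)
    qed
  next
    case (point i j b)
    then show ?thesis
      by (auto simp: bn_add_point_left intro!: normal_maps.point brandt_add_closed normal_maps_closed[OF g])
  qed
next
  case gc: (column l q \<tau>)
  from f show ?thesis
  proof cases
    case (const d)
    show ?thesis
    proof (cases d)
      case (Pt r s)
      with const have "s \<in> {1..n}" by auto
      with gc obtain i where "i \<in> {1..n}" "\<tau> i = s" by (blast dest: bij_betw_ex_preimage)
      then show ?thesis using gc const Pt const_add_column[of \<tau> n i r l q]
        by (auto intro: normal_maps.intros)
    next
      case Zero
      have "bn_add n f g = const_map n \<theta>" by (auto simp: const Zero map_defs)
      then show ?thesis by (simp add: normal_maps.const)
    qed
  next
    case (column k p \<sigma>)
    with gc obtain i where i: "i \<in> {1..n}" "\<tau> i = p" by (blast dest: bij_betw_ex_preimage)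
    with column have "\<sigma> i \<in> {1..n}" by (auto dest: bij_betwE)
    then show ?thesis using i gc column column_add_column[of \<tau> n i k \<sigma> l q]
      by (auto intro!: normal_maps.intros)
  next
    case (point i j b)
    then show ?thesis
      by (auto simp: bn_add_point_left intro!: normal_maps.point brandt_add_closed normal_maps_closed[OF g])
  qed
qed

section \<open>Closure of the normal forms under composition\<close>

lemma column_comp_column:
  assumes "bij_betw \<sigma> {1..n} {1..n}" "p \<in> {1..n}"
  shows "bn_comp n (column_map n k p \<sigma>) (column_map n l q \<tau>) =
    (if p = l then column_map n k q (\<tau> \<circ> \<sigma>) else const_map n \<theta>)"
  using bij_betwE[OF assms(1)] assms(2)
  by (auto simp: map_defs fun_eq_iff split: brandt.split)

text \<open>The support of the second factor is pulled back: its row \<open>\<sigma> i\<close> is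
  reached from row \<open>i\<close> alone, and its column \<open>j\<close> is reached only if it is
  the target column \<open>p\<close>.\<close>

lemma column_comp_point:
  assumes "bij_betw \<sigma> {1..n} {1..n}" "p \<in> {1..n}" "i \<in> {1..n}"
  shows "bn_comp n (column_map n k p \<sigma>) (point_map n (Pt (\<sigma> i) j) b) =
    (if p = j then point_map n (Pt i k) b else const_map n \<theta>)"
  using bij_betwE[OF assms(1)] inj_on_eq_iff[OF bij_betw_imp_inj_on[OF assms(1)] _ assms(3)] assms(2,3)
  by (auto simp: map_defs fun_eq_iff split: brandt.split)

lemma point_comp:
  assumes "b \<in> brandt_carrier n" "f \<theta> = \<theta>"
  shows "bn_comp n (point_map n a b) f = point_map n a (f b)"
  using assms by (auto simp: map_defs)

text \<open>Constant factors make the composite constant and are treated first. Afterwards the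
  second factor fixes \<open>\<theta>\<close>, so the composite vanishes wherever the first factor
  does.\<close>

lemma normal_maps_comp:
  assumes f: "f \<in> normal_maps n" and g: "g \<in> normal_maps n"
  shows "bn_comp n f g \<in> normal_maps n"
proof -
  have fc: "f a \<in> brandt_carrier n" if "a \<in> brandt_carrier n" for a
    using that by (rule normal_maps_closed[OF f])
  show ?thesis
  proof (cases "\<exists>d \<in> brandt_carrier n. f = const_map n d")
    case True
    then obtain d where d: "d \<in> brandt_carrier n" "f = const_map n d" by blast
    have "bn_comp n f g = const_map n (g d)" by (auto simp: d(2) map_defs)
    then show ?thesis using d(1) g by (simp add: normal_maps.const normal_maps_closed)
  next
    case f_nonconst: False
    show ?thesis
    proof (cases "\<exists>c \<in> brandt_carrier n. g = const_map n c")
      case True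
      then obtain c where c: "c \<in> brandt_carrier n" "g = const_map n c" by blast
      have "bn_comp n f g = const_map n c"
        by (auto simp: c(2) bn_comp_def const_map_def fc)
      then show ?thesis using c(1) by (simp add: normal_maps.const)
    next
      case g_nonconst: False
      \<comment> \<open>Column and point maps fix \<open>\<theta>\<close> by their form; only
        constants may fail to.\<close>
      from g g_nonconst have g0: "g \<theta> = \<theta>" by cases (auto simp: map_defs)
      from f show ?thesis
      proof cases
        case (const d)
        with f_nonconst show ?thesis by blast
      next
        case (point i j b)
        then show ?thesis using g0 g by (simp add: point_comp normal_maps.point normal_maps_closed)
      next
        case fcol: (column k p \<sigma>)
        from g show ?thesis
        proof cases
          case (const d)
          with g_nonconst show ?thesis by blast
        next
          case (column l q \<tau>)
          then show ?thesis using fcol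
            by (auto simp: column_comp_column intro!: normal_maps.intros intro: bij_betw_trans)
        next
          case (point x j b)
          with fcol obtain i where "i \<in> {1..n}" "\<sigma> i = x" by (blast dest: bij_betw_ex_preimage)
          then show ?thesis using point fcol column_comp_point[of \<sigma> n p i k j b]
            by (auto intro!: normal_maps.intros)
        qed
      qed
    qed
  qed
qed

section \<open>Classification of the endomorphisms\<close>

lemma brandt_idem: "a \<oplus>\<^sub>B a = a \<longleftrightarrow> a = \<theta> \<or> (\<exists>k. a = Pt k k)"
  by (cases a) auto

lemma Pt_add_eq_Pt_iff: "Pt i j \<oplus>\<^sub>B Pt k l = Pt x y \<longleftrightarrow> j = k \<and> i = x \<and> l = y"
  by simp

text \<open>If \<open>g \<theta>\<close> is not \<open>\<theta>\<close>, absorption forces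
  \<open>g\<close> to be constant. If \<open>g\<close> fixes \<open>\<theta>\<close> and kills one
  nonzero element, it kills all, since each element is a product through any nonzero one. Otherwise
  the diagonal idempotents go to nonzero idempotents, and this defines
  \<open>\<sigma>\<close>.\<close>

lemma brandt_endo_cases:
  assumes g: "g \<in> brandt_endo n"
  obtains (const) c where "c \<in> brandt_carrier n" "g = const_map n c"
  | (perm) \<sigma> where "bij_betw \<sigma> {1..n} {1..n}" "g = perm_map n \<sigma>"
proof -
  from g have maps: "g \<in> brandt_maps n"
    and hom: "\<And>a b. a \<in> brandt_carrier n \<Longrightarrow> b \<in> brandt_carrier n \<Longrightarrow> g (a \<oplus>\<^sub>B b) = g a \<oplus>\<^sub>B g b"
    unfolding brandt_endo_def by blast+
  note closed = PiE_mem[OF maps[unfolded brandt_maps_def]]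
    and outside = PiE_arb[OF maps[unfolded brandt_maps_def]]
  have constI: thesis if "\<And>a. a \<in> brandt_carrier n \<Longrightarrow> g a = c" for c
  proof (rule const)
    show "c \<in> brandt_carrier n" using that[of \<theta>] closed[of \<theta>] by simp
    show "g = const_map n c" using that outside by (auto simp: const_map_def)
  qed
  show thesis
  proof (cases "g \<theta> = \<theta>")
    case False
    moreover have "g \<theta> \<oplus>\<^sub>B g \<theta> = g \<theta>" using hom[of \<theta> \<theta>] by simp
    ultimately obtain k where k: "g \<theta> = Pt k k"
      unfolding brandt_idem by blast
    have "g a = Pt k k" if "a \<in> brandt_carrier n" for a
    proof -
      \<comment> \<open>Applying \<open>g\<close> to
        \<open>a + \<theta> = \<theta> = \<theta> + a\<close> makes \<open>g a\<close> a two-sided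
        identity for \<open>Pt k k\<close>; only \<open>Pt k k\<close> itself is one.\<close>
      have "Pt k k = g a \<oplus>\<^sub>B Pt k k" "Pt k k = Pt k k \<oplus>\<^sub>B g a"
        using hom[of a \<theta>] hom[of \<theta> a] that k by simp_all
      then show ?thesis by (cases "g a") (auto split: if_splits)
    qed
    then show thesis by (rule constI)
  next
    case g0: True
    show thesis
    proof (cases "\<exists>i\<in>{1..n}. \<exists>j\<in>{1..n}. g (Pt i j) = \<theta>")
      case True
      then obtain i j where ij: "i \<in> {1..n}" "j \<in> {1..n}" "g (Pt i j) = \<theta>" by blast
      have "g a = \<theta>" if "a \<in> brandt_carrier n" for a
      proof (cases a)
        case (Pt x y)
        \<comment> \<open>The zero value spreads along the factorization
          \<open>(x,y) = (x,i) + (i,j) + (j,y)\<close>.\<close>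
        with that ij have "g (Pt i y) = \<theta>" using hom[of "Pt i j" "Pt j y"] by simp
        with that ij Pt show ?thesis using hom[of "Pt x i" "Pt i y"] by simp
      qed (simp add: g0)
      then show thesis by (rule constI)
    next
      case False
      then have nz: "\<And>i j. i \<in> {1..n} \<Longrightarrow> j \<in> {1..n} \<Longrightarrow> g (Pt i j) \<noteq> \<theta>" by blast
      have "\<exists>k. g (Pt i i) = Pt k k" if "i \<in> {1..n}" for i
      proof -
        have "g (Pt i i) \<oplus>\<^sub>B g (Pt i i) = g (Pt i i)"
          using hom[of "Pt i i" "Pt i i"] that by simp
        then show ?thesis using nz[OF that that] unfolding brandt_idem by blast
      qed
      then obtain \<sigma> where \<sigma>: "\<And>i. i \<in> {1..n} \<Longrightarrow> g (Pt i i) = Pt (\<sigma> i) (\<sigma> i)" by metis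
      have \<sigma>2: "g (Pt i j) = Pt (\<sigma> i) (\<sigma> j)" if ij: "i \<in> {1..n}" "j \<in> {1..n}" for i j
      proof -
        obtain x y where xy: "g (Pt i j) = Pt x y" using nz[OF ij] by (cases "g (Pt i j)") simp_all
        \<comment> \<open>\<open>Pt i i\<close> and \<open>Pt j j\<close> are left and right
          identities of \<open>Pt i j\<close>; their images fix the two coordinates of
          \<open>g (Pt i j)\<close>.\<close>
        have "Pt (\<sigma> i) (\<sigma> i) \<oplus>\<^sub>B Pt x y = g (Pt i i) \<oplus>\<^sub>B g (Pt i j)"
          by (simp only: xy \<sigma>[OF ij(1)])
        also have "\<dots> = g (Pt i i \<oplus>\<^sub>B Pt i j)"
          by (rule hom[symmetric]) (use ij in simp_all)
        also have "\<dots> = Pt x y" by (simp add: xy)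
        finally have "x = \<sigma> i" by (metis Pt_add_eq_Pt_iff)
        have "Pt x y \<oplus>\<^sub>B Pt (\<sigma> j) (\<sigma> j) = g (Pt i j) \<oplus>\<^sub>B g (Pt j j)"
          by (simp only: xy \<sigma>[OF ij(2)])
        also have "\<dots> = g (Pt i j \<oplus>\<^sub>B Pt j j)"
          by (rule hom[symmetric]) (use ij in simp_all)
        also have "\<dots> = Pt x y" by (simp add: xy)
        finally have "y = \<sigma> j" by (metis Pt_add_eq_Pt_iff)
        show ?thesis by (simp only: xy \<open>x = \<sigma> i\<close> \<open>y = \<sigma> j\<close>)
      qed
      have "inj_on \<sigma> {1..n}"
      proof (rule inj_onI, rule ccontr)
        fix i j assume *: "i \<in> {1..n}" "j \<in> {1..n}" "\<sigma> i = \<sigma> j" "i \<noteq> j"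
        \<comment> \<open>Distinct diagonal idempotents have sum \<open>\<theta>\<close>, whereas
          equal nonzero images would have a nonzero sum.\<close>
        have "Pt (\<sigma> i) (\<sigma> i) \<oplus>\<^sub>B Pt (\<sigma> j) (\<sigma> j) = g (Pt i i) \<oplus>\<^sub>B g (Pt j j)"
          by (simp only: \<sigma>[OF *(1)] \<sigma>[OF *(2)])
        also have "\<dots> = g (Pt i i \<oplus>\<^sub>B Pt j j)"
          by (rule hom[symmetric]) (use * in simp_all)
        also have "\<dots> = \<theta>" using *(4) by (simp add: g0)
        finally show False using *(3) by simp
      qed
      moreover have "\<sigma> ` {1..n} \<subseteq> {1..n}"
      proof (rule image_subsetI)
        fix i assume "i \<in> {1..n}"
        then show "\<sigma> i \<in> {1..n}" using closed[of "Pt i i"] \<sigma>[of i] by simp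
      qed
      ultimately have "bij_betw \<sigma> {1..n} {1..n}"
        by (intro bij_betw_imageI endo_inj_surj) simp_all
      moreover have "g = perm_map n \<sigma>"
      proof
        fix a show "g a = perm_map n \<sigma> a"
          using outside[of a] g0 \<sigma>2 by (cases a) (auto simp: perm_map_def)
      qed
      ultimately show thesis by (rule perm)
    qed
  qed
qed

section \<open>Every element of the near-semiring is normal\<close>

text \<open>The value at \<open>Pt i j\<close> ends in \<open>\<sigma> j\<close>, which meets
  \<open>\<sigma> k\<close> only for \<open>j = k\<close>: the constant selects the column.\<close>

lemma perm_add_const:
  assumes "bij_betw \<sigma> {1..n} {1..n}" "k \<in> {1..n}"
  shows "bn_add n (perm_map n \<sigma>) (const_map n (Pt (\<sigma> k) p)) = column_map n k p \<sigma>"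
  using assms(2) inj_on_eq_iff[OF bij_betw_imp_inj_on[OF assms(1)]]
  by (auto simp: map_defs fun_eq_iff split: brandt.split)

lemma brandt_const_eq: "brandt_const n = const_map n ` brandt_carrier n"
  by (auto simp: brandt_const_def const_map_def)

lemma affine_maps_normal:
  assumes "f \<in> affine_maps n"
  shows "f \<in> normal_maps n"
proof -
  from assms obtain g c where g: "g \<in> brandt_endo n" and c: "c \<in> brandt_carrier n"
    and f: "f = bn_add n g (const_map n c)"
    by (auto simp: affine_maps_def brandt_const_eq)
  from g show ?thesis
  proof (cases rule: brandt_endo_cases)
    case (const d)
    then show ?thesis using c by (simp add: f normal_maps_add normal_maps.const)
  next
    case (perm \<sigma>)
    show ?thesis
    proof (cases c)
      case (Pt u p)
      with c have "u \<in> {1..n}" "p \<in> {1..n}" by auto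
      moreover from this perm obtain k where "k \<in> {1..n}" "\<sigma> k = u"
        by (blast dest: bij_betw_ex_preimage)
      ultimately show ?thesis
        using perm perm_add_const[of \<sigma> n k p] by (auto simp: f Pt intro: normal_maps.column)
    next
      case Zero
      have "f = const_map n \<theta>" by (auto simp: f Zero map_defs)
      then show ?thesis by (simp add: normal_maps.const)
    qed
  qed
qed

lemma affine_nsr_normal: "f \<in> affine_nsr n \<Longrightarrow> f \<in> normal_maps n"
  by (induction rule: affine_nsr.induct)
    (simp_all add: affine_maps_normal normal_maps_add normal_maps_comp)

section \<open>Every normal map lies in the near-semiring\<close>

lemma affine_mapsI:
  "g \<in> brandt_endo n \<Longrightarrow> c \<in> brandt_carrier n \<Longrightarrow> bn_add n g (const_map n c) \<in> affine_maps n"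
  by (auto simp: affine_maps_def brandt_const_eq)

lemma const_map_affine:
  assumes "c \<in> brandt_carrier n"
  shows "const_map n c \<in> affine_maps n"
proof -
  \<comment> \<open>An idempotent left identity of \<open>c\<close>: idempotency makes its constant
    map an endomorphism, and \<open>c = e + c\<close> is then an affine value.\<close>
  define e where "e = (case c of Pt u v \<Rightarrow> Pt u u | \<theta> \<Rightarrow> \<theta>)"
  have "e \<in> brandt_carrier n" "e \<oplus>\<^sub>B e = e" "e \<oplus>\<^sub>B c = c"
    using assms by (auto simp: e_def split: brandt.split)
  then have "const_map n e \<in> brandt_endo n"
    by (auto simp: brandt_endo_def brandt_maps_def const_map_def brandt_add_closed)
  from affine_mapsI[OF this assms]
  have "bn_add n (const_map n e) (const_map n c) \<in> affine_maps n" .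
  also have "bn_add n (const_map n e) (const_map n c) = const_map n c"
    using \<open>e \<oplus>\<^sub>B c = c\<close> by (auto simp: map_defs)
  finally show ?thesis .
qed

text \<open>Injectivity of \<open>\<sigma>\<close> keeps distinct inner indices distinct, so sums
  equal to \<open>\<theta>\<close> are preserved too.\<close>

lemma perm_map_endo:
  assumes "bij_betw \<sigma> {1..n} {1..n}"
  shows "perm_map n \<sigma> \<in> brandt_endo n"
proof -
  have "perm_map n \<sigma> (a \<oplus>\<^sub>B b) = perm_map n \<sigma> a \<oplus>\<^sub>B perm_map n \<sigma> b"
    if "a \<in> brandt_carrier n" "b \<in> brandt_carrier n" for a b
    using that inj_on_eq_iff[OF bij_betw_imp_inj_on[OF assms]] bij_betwE[OF assms]
    by (cases a; cases b) (auto simp: perm_map_def)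
  moreover have "perm_map n \<sigma> \<in> brandt_maps n"
    using bij_betwE[OF assms] by (auto simp: perm_map_def brandt_maps_def split: brandt.split)
  ultimately show ?thesis by (simp add: brandt_endo_def)
qed

text \<open>This inclusion places the generalized inverses, found among the normal maps, inside the
  near-semiring.\<close>

lemma normal_maps_affine_nsr:
  assumes "f \<in> normal_maps n"
  shows "f \<in> affine_nsr n"
proof -
  have col: "column_map n k p \<sigma> \<in> affine_nsr n"
    if "k \<in> {1..n}" "p \<in> {1..n}" "bij_betw \<sigma> {1..n} {1..n}" for k p \<sigma>
  proof -
    have "Pt (\<sigma> k) p \<in> brandt_carrier n" using that by (auto dest: bij_betwE)
    from affine_mapsI[OF perm_map_endo[OF that(3)] this] show ?thesis
      using that by (simp only: perm_add_const affine_nsr.affine)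
  qed
  from assms show ?thesis
  proof cases
    case (const c)
    then show ?thesis by (simp add: affine_nsr.affine const_map_affine)
  next
    case (column k p \<sigma>)
    then show ?thesis using col by simp
  next
    case (point i j b)
    show ?thesis
    proof (cases b)
      case (Pt r p)
      with point have rp: "r \<in> {1..n}" "p \<in> {1..n}" by auto
      have id: "bij_betw id {1..n} {1..n}" by simp
      \<comment> \<open>A point map is a constant plus a column map with the identity permutation;
        the constant's second index picks row \<open>i\<close>. Writing \<open>id i\<close> matches
        the form of \<open>const_add_column\<close>.\<close>
      have "bn_add n (const_map n (Pt r (id i))) (column_map n j p id) \<in> affine_nsr n"
        using point rp
        by (intro affine_nsr.add affine_nsr.affine const_map_affine col id) auto
      then show ?thesis
        using point by (simp only: const_add_column[OF id] Pt)
    next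
      case Zero
      then show ?thesis using point
        by (simp add: point_map_Zero affine_nsr.affine const_map_affine)
    qed
  qed
qed

lemma affine_nsr_eq_normal_maps: "affine_nsr n = normal_maps n"
  using affine_nsr_normal normal_maps_affine_nsr by blast

section \<open>Generalized inverses of the normal forms\<close>

lemma const_map_regular:
  assumes "c \<in> brandt_carrier n"
  shows "bn_comp n (bn_comp n (const_map n c) (const_map n c)) (const_map n c) = const_map n c"
  using assms by (auto simp: map_defs)

text \<open>The first two factors send \<open>(i,k)\<close> to \<open>(\<sigma> i,p)\<close> and
  back, so their composite is the identity on column \<open>k\<close> and \<open>\<theta>\<close>
  elsewhere.\<close>

lemma column_map_regular:
  assumes "k \<in> {1..n}" "p \<in> {1..n}" "bij_betw \<sigma> {1..n} {1..n}"
  defines "\<tau> \<equiv> inv_into {1..n} \<sigma>"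
  shows "bn_comp n (bn_comp n (column_map n k p \<sigma>) (column_map n p k \<tau>)) (column_map n k p \<sigma>)
    = column_map n k p \<sigma>"
proof -
  have \<tau>: "\<tau> (\<sigma> i) = i" if "i \<in> {1..n}" for i
    using assms(3) that by (simp add: \<tau>_def bij_betw_inv_into_left)
  then show ?thesis using assms(1,2) bij_betwE[OF assms(3)]
    by (auto simp: map_defs fun_eq_iff split: brandt.split)
qed

text \<open>The first two factors fix \<open>a\<close> and, as \<open>b\<close> is nonzero, send
  everything else to \<open>\<theta>\<close>.\<close>

lemma point_map_regular:
  assumes "a \<in> brandt_carrier n" "a \<noteq> \<theta>" "b \<in> brandt_carrier n" "b \<noteq> \<theta>"
  shows "bn_comp n (bn_comp n (point_map n a b) (point_map n b a)) (point_map n a b)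
    = point_map n a b"
  using assms by (auto simp: map_defs fun_eq_iff)

theorem theorem4p8:
  fixes n :: nat
  assumes "n \<ge> 1"
  shows "\<forall>f \<in> affine_nsr n. \<exists>g \<in> affine_nsr n. bn_comp n (bn_comp n f g) f = f"
proof
  fix f assume "f \<in> affine_nsr n"
  then have "f \<in> normal_maps n" by (rule affine_nsr_normal)
  then have "\<exists>g \<in> normal_maps n. bn_comp n (bn_comp n f g) f = f"
  proof cases
    case (const c)
    then show ?thesis using const_map_regular normal_maps.const by blast
  next
    case (column k p \<sigma>)
    then show ?thesis using column_map_regular normal_maps.column bij_betw_inv_into by blast
  next
    case (point i j b)
    \<comment> \<open>Swapping source and target yields a point map covered by
      \<open>normal_maps.point\<close> when \<open>b\<close> is nonzero; for
      \<open>b = \<theta>\<close> the map is the zero constant.\<close>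
    show ?thesis
    proof (cases b)
      case (Pt r s)
      then show ?thesis using point point_map_regular[of "Pt i j" n b]
        by (auto intro!: bexI[of _ "point_map n b (Pt i j)"] normal_maps.point)
    next
      case Zero
      then show ?thesis using point const_map_regular normal_maps.const
        by (metis point_map_Zero)
    qed
  qed
  then show "\<exists>g \<in> affine_nsr n. bn_comp n (bn_comp n f g) f = f"
    by (simp add: affine_nsr_eq_normal_maps)
qed

end
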